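(* Let $\mathcal{X}\subset[0,\infty)$ be a fixed finite set (constellation), let $P$ be a fixed probability distribution on $\mathcal{X}$, and let $\mu_1=\sum_{x\in\mathcal{X}}P(x)x$ (assumed positive) and $\mu_2=\sum_{x\in\mathcal{X}}P(x)x^2$ be its first- and second-order moments. Let $X$ have distribution $P$, let $S(X)$ be, conditionally on $X=x$, Poisson with parameter $\varepsilon_s x$, where $\varepsilon_s>0$, and let $Z$ be a noise independent of $(X,S(X))$. Then the mutual information (in nats) satisfies, as $\varepsilon_s\to 0^+$, $$I\bigl(X;S(X)+Z\bigr)=c_1\varepsilon_s+c_2\varepsilon_s^2+o(\varepsilon_s^2),$$ where: (i) in the absence of additive noise, i.e. for $Z=0$, $$c_1=\sum_{x\in\mathcal{X}}P(x)\,x\log\frac{x}{\mu_1},\qquad c_2=\frac12\left(\mu_2-\mu_1^2-\mu_2\log\frac{\mu_2}{\mu_1^2}\right);$$ (ii) if $Z$ has mean $\varepsilon_n>0$ (fixed, independent of $\varepsilon_s$), regardless of whether $Z$ has a Poisson or a geometric distribution, $$c_1=0,\qquad c_2=\frac12\,\frac{\mu_2-\mu_1^2}{\varepsilon_n}.$$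
   Context: Logarithms are natural, and $0\log 0=0$ (so a point $x=0$ of the constellation contributes $0$ to $c_1$ in the noiseless case). Poisson noise of mean $\varepsilon_n$ means $\Pr(Z=z)=e^{-\varepsilon_n}\varepsilon_n^z/z!$, and geometric noise of mean $\varepsilon_n$ means $\Pr(Z=z)=\frac{1}{1+\varepsilon_n}\left(\frac{\varepsilon_n}{1+\varepsilon_n}\right)^z$, for $z=0,1,2,\dots$. A Poisson variable of parameter $0$ equals $0$ with probability one. *)

theory Defs
  imports "HOL-Probability.Probability" "HOL-Library.Landau_Symbols"
begin

(* poisson_pmf is specified only for positive rates. *)
definition poisson_law :: "real \<Rightarrow> nat pmf" where
  "poisson_law r = (if r = 0 then return_pmf 0 else poisson_pmf r)"

(* Independence of (X, S) and Z is independence of the generated sigma-algebras;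
   indep_var would need both variables to have the same type.
   P may vanish at points of \<X>; the conditional law of S given X = x is constrained
   only where the conditioning event has positive probability. *)
locale poisson_channel = prob_space M
  for M :: "'w measure" +
  fixes \<X> :: "real set" and P :: "real pmf" and N :: "nat pmf" and \<epsilon> :: real
    and X :: "'w \<Rightarrow> real" and S :: "'w \<Rightarrow> nat" and Z :: "'w \<Rightarrow> nat"
  assumes X_measurable: "X \<in> measurable M (count_space \<X>)"
    and S_measurable: "S \<in> measurable M (count_space UNIV)"
    and Z_measurable: "Z \<in> measurable M (count_space UNIV)"
    and X_law: "\<And>x. x \<in> \<X> \<Longrightarrow> \<P>(\<omega> in M. X \<omega> = x) = pmf P x"
    and S_law: "\<And>x k. x \<in> \<X> \<Longrightarrow> pmf P x > 0 \<Longrightarrow>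
          \<P>(\<omega> in M. S \<omega> = k \<bar> X \<omega> = x) = pmf (poisson_law (\<epsilon> * x)) k"
    and Z_law: "\<And>z. \<P>(\<omega> in M. Z \<omega> = z) = pmf N z"
    and Z_indep: "indep_set
          (sets (vimage_algebra (space M) (\<lambda>\<omega>. (X \<omega>, S \<omega>)) (count_space \<X> \<Otimes>\<^sub>M count_space UNIV)))
          (sets (vimage_algebra (space M) Z (count_space UNIV)))"

end

(* With c(t) = t ln t, the mutual information is the sum over outputs k of the Jensen gap
   E[c(W)] - c(E[W]), where W = Pr(output = k | X) as a function of X. The gap is homogeneous
   in W, and it is at most b^2 when |W - 1| <= b, by 0 <= t ln t - t + 1 <= (t - 1)^2.
   With noise, dividing W by Pr(Z = k) gives 1 + eps X (Pr(Z = k - 1) / Pr(Z = k) - 1) + O(eps^2),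
   so gap / eps^2 converges for each k to half the variance of the first-order term and is
   dominated; summing over k leaves E[(Pr(Z = z - 1) / Pr(Z = z) - 1)^2] = 1 / eps_n for both
   noise laws. Without noise, dividing W by eps^k / k! gives exp(-eps X) X^k, and only
   k = 0 (to second order), k = 1 (to first order) and k = 2 (at eps = 0) contribute. *)
theory Submission
  imports Defs "HOL-Real_Asymp.Real_Asymp"
begin

section \<open>Jensen gap of \<open>t ln t\<close>\<close>

text \<open>For a fixed output \<open>k\<close> the limit is a Taylor expansion; the obstacle is
  passing to the limit under the infinite sum over \<open>k\<close>. Under Poisson noise the
  conditional output probability, divided by \<open>Pr(Z = k)\<close>, is not close to 1 uniformly
  in \<open>k\<close>: its deviation per unit of \<epsilon> is controlled only by a bound of order
  \<open>(1 + a / \<epsilon>\<^sub>n) ^ k\<close>, with \<open>a\<close> the largest point of the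
  constellation. A quadratic bound on the gap, free of logarithms, asks only that the square of this
  bound be summable against the noise law, and the factorial in the Poisson law ensures that.

  The constant \<open>1 / \<epsilon>\<^sub>n\<close> is the Fisher information of the noise about
  the rate of a small added Poisson count, at rate 0. The scores of the two laws differ:
  \<open>k / \<epsilon>\<^sub>n - 1\<close> for Poisson noise; for geometric noise
  \<open>1 / \<epsilon>\<^sub>n\<close> when \<open>k > 0\<close> and \<open>-1\<close> when
  \<open>k = 0\<close>. Only their second moments agree, and nothing else about the noise reaches
  second order.\<close>

definition jensen_gap :: "'a set \<Rightarrow> ('a \<Rightarrow> real) \<Rightarrow> ('a \<Rightarrow> real) \<Rightarrow> real" where
  "jensen_gap A p w =
     (\<Sum>x\<in>A. p x * (w x * ln (w x))) - (\<Sum>x\<in>A. p x * w x) * ln (\<Sum>x\<in>A. p x * w x)"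

lemma xlnx_mult:
  fixes c t :: real
  assumes "c > 0" and "t \<ge> 0"
  shows "c * t * ln (c * t) = c * (t * ln t) + c * t * ln c"
  using assms by (cases "t = 0") (auto simp: ln_mult algebra_simps)

text \<open>The factor contributes \<open>c * ln c\<close> times the mean to both halves of the gap,
  where it cancels. Hence a factor such as \<open>\<epsilon> ^ k / fact k\<close> can be pulled out
  without leaving terms in \<open>ln \<epsilon>\<close>.\<close>

lemma jensen_gap_mult:
  assumes "c > 0" and "\<And>x. x \<in> A \<Longrightarrow> p x \<ge> 0" and "\<And>x. x \<in> A \<Longrightarrow> w x \<ge> 0"
  shows "jensen_gap A p (\<lambda>x. c * w x) = c * jensen_gap A p w"
proof -
  define m where "m = (\<Sum>x\<in>A. p x * w x)"
  have "m \<ge> 0"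
    unfolding m_def using assms by (intro sum_nonneg mult_nonneg_nonneg)
  have m: "(\<Sum>x\<in>A. p x * (c * w x)) = c * m"
    by (simp add: m_def sum_distrib_left mult_ac)
  have "(\<Sum>x\<in>A. p x * (c * w x * ln (c * w x)))
      = (\<Sum>x\<in>A. c * (p x * (w x * ln (w x))) + c * ln c * (p x * w x))"
    using assms by (intro sum.cong refl, subst xlnx_mult) (auto simp: algebra_simps)
  also have "\<dots> = c * (\<Sum>x\<in>A. p x * (w x * ln (w x))) + c * ln c * m"
    by (simp add: m_def sum.distrib sum_distrib_left)
  finally show ?thesis
    unfolding jensen_gap_def m xlnx_mult[OF \<open>c > 0\<close> \<open>m \<ge> 0\<close>]
    by (simp add: m_def algebra_simps)
qed

text \<open>Adding an affine function to \<^term>\<open>\<lambda>t::real. t * ln t\<close> does not change its Jensen gap; this one makes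
  it vanish to second order at 1.\<close>

definition bregman :: "real \<Rightarrow> real" where
  "bregman t = t * ln t - t + 1"

text \<open>Both bounds are \<open>ln u \<le> u - 1\<close>: at \<open>u = 1 / t\<close> for the
  lower one, at \<open>u = t\<close> for the upper one.\<close>

lemma bregman_bounds:
  assumes "t \<ge> 0"
  shows "0 \<le> bregman t" and "bregman t \<le> (t - 1)\<^sup>2"
proof -
  show "0 \<le> bregman t"
  proof (cases "t = 0")
    case False
    then have "t > 0" using assms by simp
    have "- ln t = ln (1 / t)" using \<open>t > 0\<close> by (simp add: ln_div)
    also have "\<dots> \<le> 1 / t - 1" using \<open>t > 0\<close> by (intro ln_le_minus_one) simp
    finally have "t * (1 - 1 / t) \<le> t * ln t" using \<open>t > 0\<close> by (intro mult_left_mono) auto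
    moreover have "t * (1 - 1 / t) = t - 1" using \<open>t > 0\<close> by (simp add: field_simps)
    ultimately show ?thesis by (simp add: bregman_def)
  qed (simp add: bregman_def)
  show "bregman t \<le> (t - 1)\<^sup>2"
  proof (cases "t = 0")
    case False
    then have "t * ln t \<le> t * (t - 1)"
      using assms by (intro mult_left_mono ln_le_minus_one) auto
    then show ?thesis by (simp add: bregman_def power2_eq_square algebra_simps)
  qed (simp add: bregman_def)
qed

lemma jensen_gap_bregman:
  assumes "sum p A = 1"
  shows "jensen_gap A p w = (\<Sum>x\<in>A. p x * bregman (w x)) - bregman (\<Sum>x\<in>A. p x * w x)"
proof -
  have "(\<Sum>x\<in>A. p x * bregman (w x))
      = (\<Sum>x\<in>A. p x * (w x * ln (w x)) - p x * w x + p x)"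
    by (intro sum.cong) (auto simp: bregman_def algebra_simps)
  then show ?thesis
    using assms by (simp add: jensen_gap_def bregman_def sum.distrib sum_subtractf)
qed

text \<open>The mean of \<open>w\<close> is within \<open>b\<close> of 1 as well, so both Bregman
  terms lie between 0 and \<open>b^2\<close>. Their difference is therefore at most
  \<open>b^2\<close> in absolute value, without a factor 2.\<close>

lemma jensen_gap_bound:
  assumes p: "\<And>x. x \<in> A \<Longrightarrow> p x \<ge> 0" "sum p A = 1"
    and w: "\<And>x. x \<in> A \<Longrightarrow> w x \<ge> 0" "\<And>x. x \<in> A \<Longrightarrow> \<bar>w x - 1\<bar> \<le> b"
  shows "\<bar>jensen_gap A p w\<bar> \<le> b\<^sup>2"
proof -
  define m where "m = (\<Sum>x\<in>A. p x * w x)"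
  have "m \<ge> 0"
    unfolding m_def using assms by (intro sum_nonneg mult_nonneg_nonneg)
  have "m - 1 = (\<Sum>x\<in>A. p x * (w x - 1))"
    using p(2) by (simp add: m_def algebra_simps sum_subtractf)
  also have "\<bar>\<dots>\<bar> \<le> (\<Sum>x\<in>A. p x * b)"
    using p(1) w(2) by (intro order.trans[OF sum_abs] sum_mono) (auto simp: abs_mult intro: mult_left_mono)
  also have "\<dots> = b" using p(2) by (simp flip: sum_distrib_right)
  finally have "bregman m \<le> b\<^sup>2"
    using bregman_bounds(2)[OF \<open>m \<ge> 0\<close>] abs_le_square_iff[of "m - 1" b] by linarith
  moreover have "bregman (w x) \<le> b\<^sup>2" if "x \<in> A" for x
    using bregman_bounds(2)[of "w x"] w[OF that] abs_le_square_iff[of "w x - 1" b] by linarith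
  then have "(\<Sum>x\<in>A. p x * bregman (w x)) \<le> (\<Sum>x\<in>A. p x * b\<^sup>2)"
    using p(1) by (intro sum_mono mult_left_mono) auto
  then have "(\<Sum>x\<in>A. p x * bregman (w x)) \<le> b\<^sup>2"
    using p(2) by (simp flip: sum_distrib_right)
  moreover have "0 \<le> (\<Sum>x\<in>A. p x * bregman (w x))"
    using p(1) w(1) bregman_bounds(1) by (intro sum_nonneg mult_nonneg_nonneg) auto
  ultimately show ?thesis
    unfolding jensen_gap_bregman[OF p(2)] using bregman_bounds(1)[OF \<open>m \<ge> 0\<close>]
    by (simp add: m_def)
qed

lemma tendsto_bregman:
  assumes "((\<lambda>\<epsilon>. (w \<epsilon> - 1) / \<epsilon>) \<longlongrightarrow> v) (at_right 0)"
  shows "((\<lambda>\<epsilon>. bregman (w \<epsilon>) / \<epsilon>\<^sup>2) \<longlongrightarrow> v\<^sup>2 / 2) (at_right 0)"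
proof -
  \<comment> \<open>With the removable singularity filled in,
    \<open>bregman (w \<epsilon>) / \<epsilon>^2\<close> factors as a squared difference quotient
    times \<open>h (w \<epsilon> - 1)\<close> even where \<open>w \<epsilon> = 1\<close>. The value
    \<open>1 / 2\<close> is half the second derivative of \<open>t * ln t\<close> at 1.\<close>
  define h where "h u = (if u = 0 then 1 / 2 else bregman (1 + u) / u\<^sup>2)" for u
  have "(\<lambda>u. bregman (1 + u) / u\<^sup>2) \<midarrow>0\<rightarrow> 1 / 2"
    unfolding bregman_def by real_asymp
  moreover have "\<forall>\<^sub>F u in at 0. bregman (1 + u) / u\<^sup>2 = h u"
    by (auto simp: h_def eventually_at_filter)
  ultimately have h: "h \<midarrow>0\<rightarrow> h 0"
    using Lim_transform_eventually[of _ "h 0"] by (force simp: h_def)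
  have nz: "\<forall>\<^sub>F \<epsilon> in at_right 0. \<epsilon> \<noteq> (0 :: real)"
    by (auto simp: eventually_at_filter)
  have "((\<lambda>\<epsilon>. (w \<epsilon> - 1) / \<epsilon> * \<epsilon>) \<longlongrightarrow> v * 0) (at_right 0)"
    by (intro tendsto_mult assms tendsto_ident_at)
  moreover have "\<forall>\<^sub>F \<epsilon> in at_right 0. (w \<epsilon> - 1) / \<epsilon> * \<epsilon> = w \<epsilon> - 1"
    using nz by eventually_elim simp
  ultimately have "((\<lambda>\<epsilon>. w \<epsilon> - 1) \<longlongrightarrow> 0) (at_right 0)"
    using Lim_transform_eventually by force
  then have "((\<lambda>\<epsilon>. h (w \<epsilon> - 1)) \<longlongrightarrow> h 0) (at_right 0)"
    using h by (intro isCont_tendsto_compose[where g = h]) (auto simp: isCont_def)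
  then have "((\<lambda>\<epsilon>. ((w \<epsilon> - 1) / \<epsilon>)\<^sup>2 * h (w \<epsilon> - 1)) \<longlongrightarrow> v\<^sup>2 * h 0) (at_right 0)"
    by (intro tendsto_mult tendsto_power assms)
  moreover have "((w \<epsilon> - 1) / \<epsilon>)\<^sup>2 * h (w \<epsilon> - 1) = bregman (w \<epsilon>) / \<epsilon>\<^sup>2" for \<epsilon>
    by (auto simp: h_def bregman_def power_divide)
  ultimately show ?thesis
    by (simp add: h_def)
qed

text \<open>The mean of \<open>w\<close> has the mean of \<open>v\<close> as its first-order
  coefficient. The two Bregman terms thus give half the second moment and half the squared mean of
  \<open>v\<close>.\<close>

lemma tendsto_jensen_gap:
  assumes p: "sum p A = 1"
    and w: "\<And>x. x \<in> A \<Longrightarrow> ((\<lambda>\<epsilon>. (w \<epsilon> x - 1) / \<epsilon>) \<longlongrightarrow> v x) (at_right 0)"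
  shows "((\<lambda>\<epsilon>. jensen_gap A p (w \<epsilon>) / \<epsilon>\<^sup>2) \<longlongrightarrow>
           ((\<Sum>x\<in>A. p x * (v x)\<^sup>2) - (\<Sum>x\<in>A. p x * v x)\<^sup>2) / 2) (at_right 0)"
proof -
  have "((\<lambda>\<epsilon>. \<Sum>x\<in>A. p x * ((w \<epsilon> x - 1) / \<epsilon>)) \<longlongrightarrow> (\<Sum>x\<in>A. p x * v x)) (at_right 0)"
    by (intro tendsto_sum tendsto_mult tendsto_const w)
  moreover have "(\<Sum>x\<in>A. p x * ((w \<epsilon> x - 1) / \<epsilon>)) = ((\<Sum>x\<in>A. p x * w \<epsilon> x) - 1) / \<epsilon>" for \<epsilon>
    using p by (simp add: right_diff_distrib diff_divide_distrib sum_subtractf flip: sum_divide_distrib)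
  ultimately have "((\<lambda>\<epsilon>. ((\<Sum>x\<in>A. p x * w \<epsilon> x) - 1) / \<epsilon>) \<longlongrightarrow> (\<Sum>x\<in>A. p x * v x)) (at_right 0)"
    by simp
  then have "((\<lambda>\<epsilon>. (\<Sum>x\<in>A. p x * (bregman (w \<epsilon> x) / \<epsilon>\<^sup>2)) - bregman (\<Sum>x\<in>A. p x * w \<epsilon> x) / \<epsilon>\<^sup>2)
      \<longlongrightarrow> (\<Sum>x\<in>A. p x * ((v x)\<^sup>2 / 2)) - (\<Sum>x\<in>A. p x * v x)\<^sup>2 / 2) (at_right 0)"
    by (intro tendsto_diff tendsto_sum tendsto_mult tendsto_const tendsto_bregman w)
  then show ?thesis
    by (simp add: jensen_gap_bregman[OF p] diff_divide_distrib sum_divide_distrib)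
qed

text \<open>Tannery's theorem, with a bound that holds for all \<open>k\<close> at once eventually
  in \<open>n\<close>, so that the \<open>k\<close> component of the product filter imposes
  nothing.\<close>

lemma tendsto_suminf_dominated:
  fixes a :: "'b \<Rightarrow> nat \<Rightarrow> real"
  assumes "\<And>k. ((\<lambda>n. a n k) \<longlongrightarrow> b k) F"
    and "eventually (\<lambda>n. \<forall>k. \<bar>a n k\<bar> \<le> c k) F" and "summable c" and "F \<noteq> bot"
  shows "((\<lambda>n. \<Sum>k. a n k) \<longlongrightarrow> suminf b) F"
proof -
  have "eventually (\<lambda>(k, n). norm (a n k) \<le> c k) (at_top \<times>\<^sub>F F)"
    using assms(2) by (subst eventually_prod_filter)
      (auto intro!: exI[of _ "\<lambda>_. True"] exI[of _ "\<lambda>n. \<forall>k. \<bar>a n k\<bar> \<le> c k"])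
  from tannerys_theorem[OF assms(1) this assms(3,4)] show ?thesis by simp
qed

section \<open>Mutual information as a sum of Jensen gaps\<close>

text \<open>A crude majorant without logarithms. It serves for the integrability of the information
  density and for domination in the noiseless case.\<close>

lemma abs_xlnx_le:
  fixes t :: real
  assumes "t \<ge> 0"
  shows "\<bar>t * ln t\<bar> \<le> 1 + t\<^sup>2"
proof -
  have "t * ln t \<ge> t - 1" "t * ln t \<le> t\<^sup>2 - t"
    using bregman_bounds[OF assms] by (auto simp: bregman_def power2_diff)
  moreover have "t\<^sup>2 \<ge> 0" by simp
  ultimately show ?thesis
    using assms by (intro abs_leI) linarith+
qed

text \<open>\<open>W x k\<close> stands for the conditional probability of \<open>Y = k\<close>
  given \<open>X = x\<close>. It enters only through the joint law, so at points with
  \<open>p x = 0\<close> it may be any nonnegative number.\<close>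

lemma (in prob_space) mutual_information_sums_jensen_gap:
  fixes X :: "'a \<Rightarrow> 'b" and Y :: "'a \<Rightarrow> nat" and W :: "'b \<Rightarrow> nat \<Rightarrow> real"
  assumes A: "finite A" and X: "X \<in> measurable M (count_space A)"
    and Y: "Y \<in> measurable M (count_space UNIV)"
    and p: "\<And>x. x \<in> A \<Longrightarrow> \<P>(\<omega> in M. X \<omega> = x) = p x"
    and W: "\<And>x k. x \<in> A \<Longrightarrow> W x k \<ge> 0"
    and joint: "\<And>x k. x \<in> A \<Longrightarrow> \<P>(\<omega> in M. X \<omega> = x \<and> Y \<omega> = k) = p x * W x k"
  shows "(\<lambda>k. jensen_gap A p (\<lambda>x. W x k)) sums
           mutual_information (exp 1) (count_space A) (count_space UNIV) X Y"
proof -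
  interpret information_space M "exp 1" by standard simp
  note [measurable] = X Y
  define q where "q k = (\<Sum>x\<in>A. p x * W x k)" for k
  have p_nonneg: "p x \<ge> 0" if "x \<in> A" for x
    using p[OF that, symmetric] by simp
  have le_q: "p x * W x k \<le> q k" if "x \<in> A" for x k
    unfolding q_def using A that p_nonneg W
    by (intro member_le_sum[where f = "\<lambda>x. p x * W x k"]) auto
  have q_nonneg: "q k \<ge> 0" for k
    unfolding q_def using p_nonneg W by (intro sum_nonneg) auto
  have XA: "X \<omega> \<in> A" if "\<omega> \<in> space M" for \<omega>
    using measurable_space[OF X that] by simp
  have meas: "{\<omega>\<in>space M. X \<omega> = x \<and> Y \<omega> = k} \<in> events" if "x \<in> A" for x k
  proof -
    have "X -` {x} \<inter> space M \<in> events" "Y -` {k} \<inter> space M \<in> events"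
      using that by (auto intro!: measurable_sets[OF X] measurable_sets[OF Y])
    then have "(X -` {x} \<inter> space M) \<inter> (Y -` {k} \<inter> space M) \<in> events" by blast
    then show ?thesis by (rule back_subst[of "\<lambda>B. B \<in> events"]) auto
  qed
  have q: "\<P>(\<omega> in M. Y \<omega> = k) = q k" for k
  proof -
    have "{\<omega>\<in>space M. Y \<omega> = k} = (\<Union>x\<in>A. {\<omega>\<in>space M. X \<omega> = x \<and> Y \<omega> = k})"
      using XA by auto
    also have "prob \<dots> = (\<Sum>x\<in>A. \<P>(\<omega> in M. X \<omega> = x \<and> Y \<omega> = k))"
      using A meas by (intro finite_measure_finite_Union) (auto simp: disjoint_family_on_def)
    finally show ?thesis by (simp add: q_def joint)
  qed
  have "(\<lambda>k. prob (Y -` {k} \<inter> space M)) sums prob (\<Union>k. Y -` {k} \<inter> space M)"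
    by (intro finite_measure_UNION) (auto simp: disjoint_family_on_def intro!: measurable_sets[OF Y])
  moreover have "Y -` {k} \<inter> space M = {\<omega>\<in>space M. Y \<omega> = k}" for k by auto
  ultimately have summable_q: "summable q"
    by (simp add: q sums_iff)

  have dX: "distributed M (count_space A) X p"
    unfolding distributed_def
  proof (intro conjI measure_eqI_countable)
    fix x assume "x \<in> A"
    moreover have "X -` {x} \<inter> space M = {\<omega>\<in>space M. X \<omega> = x}" by auto
    ultimately show "emeasure (distr M (count_space A) X) {x} = emeasure (density (count_space A) p) {x}"
      by (simp add: emeasure_distr emeasure_density emeasure_eq_measure p
        nn_integral_count_space_indicator nn_integral_indicator_singleton X)
  qed (use A in \<open>auto simp: countable_finite\<close>)
  have dY: "distributed M (count_space UNIV) Y q"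
    unfolding distributed_def
  proof (intro conjI measure_eqI_countable)
    fix k :: nat
    have "Y -` {k} \<inter> space M = {\<omega>\<in>space M. Y \<omega> = k}" by auto
    then show "emeasure (distr M (count_space UNIV) Y) {k} = emeasure (density (count_space UNIV) q) {k}"
      by (simp add: emeasure_distr emeasure_density emeasure_eq_measure q
        nn_integral_count_space_indicator nn_integral_indicator_singleton Y)
  qed auto
  have pair: "count_space A \<Otimes>\<^sub>M count_space (UNIV :: nat set) = count_space (A \<times> UNIV)"
    using A by (intro pair_measure_countable) (auto simp: countable_finite)
  have mXY: "(\<lambda>\<omega>. (X \<omega>, Y \<omega>)) \<in> measurable M (count_space (A \<times> UNIV))"
    unfolding pair[symmetric] by measurable
  have dXY: "distributed M (count_space A \<Otimes>\<^sub>M count_space UNIV) (\<lambda>\<omega>. (X \<omega>, Y \<omega>)) (\<lambda>(x, k). p x * W x k)"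
    unfolding distributed_def pair
  proof (intro conjI measure_eqI_countable)
    fix z :: "'b \<times> nat" assume z: "z \<in> A \<times> UNIV"
    have "(\<lambda>\<omega>. (X \<omega>, Y \<omega>)) -` {z} \<inter> space M = {\<omega>\<in>space M. X \<omega> = fst z \<and> Y \<omega> = snd z}" by auto
    with z show "emeasure (distr M (count_space (A \<times> UNIV)) (\<lambda>\<omega>. (X \<omega>, Y \<omega>))) {z} =
        emeasure (density (count_space (A \<times> UNIV)) (\<lambda>z. ennreal (case z of (x, k) \<Rightarrow> p x * W x k))) {z}"
      by (auto simp: emeasure_distr emeasure_density emeasure_eq_measure joint
        nn_integral_count_space_indicator nn_integral_indicator_singleton mXY)
  qed (use A mXY in \<open>auto simp: countable_finite\<close>)

  define f where "f x k = p x * W x k * ln (p x * W x k / (p x * q k))" for x k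
  have S: "sigma_finite_measure (count_space A)"
    using A by (rule sigma_finite_measure_count_space_finite)
  have T: "sigma_finite_measure (count_space (UNIV :: nat set))"
    by (rule sigma_finite_measure_count_space)
  interpret pair_sigma_finite "count_space A" "count_space (UNIV :: nat set)"
    using S T by (rule pair_sigma_finite.intro)
  have I: "mutual_information (exp 1) (count_space A) (count_space UNIV) X Y
      = integral\<^sup>L (count_space A \<Otimes>\<^sub>M count_space UNIV) (\<lambda>z. f (fst z) (snd z))"
    by (subst mutual_information_distr[OF S T dX _ dY _ dXY])
       (auto simp: p_nonneg q_nonneg W f_def log_def case_prod_unfold)

  \<comment> \<open>Since \<open>p x * W x k \<le> q k\<close>, the likelihood ratio
    \<open>t = W x k / q k\<close> is at most \<open>1 / p x\<close>. The density is thus a constant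
    depending on \<open>x\<close> times \<open>q k\<close>, and \<open>q\<close> is summable. If
    \<open>p x\<close> or \<open>q k\<close> is 0, then \<open>f x k = 0\<close>.\<close>
  have f_bound: "\<bar>f x k\<bar> \<le> p x * (1 + (1 / p x)\<^sup>2) * q k" if x: "x \<in> A" for x k
  proof (cases "p x = 0 \<or> q k = 0")
    case True
    then show ?thesis
      using le_q[OF x, of k] p_nonneg[OF x] q_nonneg[of k] W[OF x, of k]
      by (auto simp: f_def)
  next
    case False
    then have pos: "p x > 0" "q k > 0"
      using p_nonneg[OF x] q_nonneg[of k] by auto
    define t where "t = W x k / q k"
    have t: "t \<ge> 0" "t \<le> 1 / p x"
      using le_q[OF x, of k] pos W[OF x, of k] by (auto simp: t_def field_simps)
    have "f x k = p x * q k * (t * ln t)"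
      using pos by (simp add: f_def t_def)
    then have "\<bar>f x k\<bar> = p x * q k * \<bar>t * ln t\<bar>"
      using pos by (simp add: abs_mult)
    also have "\<dots> \<le> p x * q k * (1 + t\<^sup>2)"
      using pos abs_xlnx_le[OF t(1)] by (intro mult_left_mono) auto
    also have "\<dots> \<le> p x * q k * (1 + (1 / p x)\<^sup>2)"
      using pos t by (intro mult_left_mono add_left_mono power_mono) auto
    finally show ?thesis by (simp add: mult_ac)
  qed
  have summable_f: "summable (\<lambda>k. \<bar>f x k\<bar>)" if "x \<in> A" for x
    by (rule summable_comparison_test'[OF summable_mult[OF summable_q, of "p x * (1 + (1 / p x)\<^sup>2)"], of 0])
       (use f_bound[OF that] in simp)
  then have int_f: "integrable (count_space UNIV) (f x)" if "x \<in> A" for x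
    using that by (simp add: integrable_count_space_nat_iff)
  \<comment> \<open>The integral of a non-integrable function is 0 by convention, so integrability
    must be known before the double integral can be read as an iterated sum.\<close>
  have "integrable (count_space A \<Otimes>\<^sub>M count_space UNIV) (\<lambda>z. f (fst z) (snd z))"
  proof (rule Fubini_integrable)
    show "(\<lambda>z. f (fst z) (snd z)) \<in> borel_measurable (count_space A \<Otimes>\<^sub>M count_space UNIV)"
      unfolding pair by simp
    show "integrable (count_space A) (\<lambda>x. LINT y|count_space UNIV. norm (f (fst (x, y)) (snd (x, y))))"
      using A by (rule integrable_count_space)
    show "AE x in count_space A. integrable (count_space UNIV) (\<lambda>y. f (fst (x, y)) (snd (x, y)))"
      using int_f by (auto simp: AE_count_space)
  qed
  from integral_fst'[OF this] A
  have I': "mutual_information (exp 1) (count_space A) (count_space UNIV) X Y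
      = (\<Sum>x\<in>A. LINT k|count_space UNIV. f x k)"
    unfolding I by (simp add: lebesgue_integral_count_space_finite)
  have "(\<lambda>k. \<Sum>x\<in>A. f x k) sums (\<Sum>x\<in>A. LINT k|count_space UNIV. f x k)"
    using int_f by (intro sums_sum sums_integral_count_space_nat)
  moreover have "(\<Sum>x\<in>A. f x k) = jensen_gap A p (\<lambda>x. W x k)" for k
  proof -
    have "f x k = p x * (W x k * ln (W x k)) - p x * W x k * ln (q k)" if x: "x \<in> A" for x
    proof (cases "p x * W x k = 0")
      case False
      then have "p x > 0" "W x k > 0"
        using p_nonneg[OF x] W[OF x, of k] by (auto simp: less_le)
      moreover from this have "q k > 0"
        using le_q[OF x, of k] by (smt (verit) mult_pos_pos)
      ultimately show ?thesis
        by (simp add: f_def ln_div algebra_simps)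
    qed (auto simp: f_def)
    then have "(\<Sum>x\<in>A. f x k) = (\<Sum>x\<in>A. p x * (W x k * ln (W x k)) - p x * W x k * ln (q k))"
      by (rule sum.cong[OF refl])
    also have "\<dots> = jensen_gap A p (\<lambda>x. W x k)"
      by (simp add: jensen_gap_def q_def sum_subtractf sum_distrib_right)
    finally show ?thesis .
  qed
  ultimately show ?thesis
    by (simp add: I')
qed

section \<open>Conditional law of the channel output\<close>

lemma pmf_poisson_law:
  assumes "r \<ge> 0"
  shows "pmf (poisson_law r) k = r ^ k / fact k * exp (- r)"
  \<comment> \<open>Since \<open>0 ^ 0 = 1\<close>, the Poisson formula at rate 0 is the point mass
    at 0; the point \<open>x = 0\<close> then needs no separate treatment.\<close>
  using assms by (cases "r = 0") (auto simp: poisson_law_def power_0_left indicator_def)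

definition output_prob :: "nat pmf \<Rightarrow> real \<Rightarrow> real \<Rightarrow> nat \<Rightarrow> real" where
  "output_prob N \<epsilon> x k = (\<Sum>j\<le>k. pmf (poisson_law (\<epsilon> * x)) j * pmf N (k - j))"

lemma (in poisson_channel) joint_law:
  assumes x: "x \<in> \<X>"
  shows "\<P>(\<omega> in M. X \<omega> = x \<and> S \<omega> + Z \<omega> = k) = pmf P x * output_prob N \<epsilon> x k"
proof -
  have X: "{\<omega>\<in>space M. X \<omega> = x} \<in> events"
    using measurable_sets[OF X_measurable, of "{x}"] x by (simp add: vimage_def Int_def conj_commute)
  have XS: "\<P>(\<omega> in M. X \<omega> = x \<and> S \<omega> = j) = pmf P x * pmf (poisson_law (\<epsilon> * x)) j" for j
  \<comment> \<open>The conditional law of \<open>S\<close> is known only where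
    \<open>pmf P x > 0\<close>; at null points both sides are 0.\<close>
  proof (cases "pmf P x = 0")
    case True
    have "\<P>(\<omega> in M. X \<omega> = x \<and> S \<omega> = j) \<le> \<P>(\<omega> in M. X \<omega> = x)"
      using X by (intro finite_measure_mono) auto
    then show ?thesis using True by (simp add: X_law[OF x] measure_le_0_iff)
  next
    case False
    then have "pmf P x > 0" by (simp add: pmf_pos)
    with S_law[OF x this, of j, unfolded cond_prob_def X_law[OF x]] show ?thesis
      by (simp add: conj_commute field_simps)
  qed
  define E where "E j = {\<omega>\<in>space M. X \<omega> = x \<and> S \<omega> = j}" for j
  define F where "F j = {\<omega>\<in>space M. Z \<omega> = j}" for j
  have E: "E j \<in> sets (vimage_algebra (space M) (\<lambda>\<omega>. (X \<omega>, S \<omega>)) (count_space \<X> \<Otimes>\<^sub>M count_space UNIV))" for j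
  proof -
    have "(\<lambda>\<omega>. (X \<omega>, S \<omega>)) -` ({x} \<times> {j}) \<inter> space M
        \<in> sets (vimage_algebra (space M) (\<lambda>\<omega>. (X \<omega>, S \<omega>)) (count_space \<X> \<Otimes>\<^sub>M count_space UNIV))"
      using x by (intro in_vimage_algebra pair_measureI) auto
    also have "(\<lambda>\<omega>. (X \<omega>, S \<omega>)) -` ({x} \<times> {j}) \<inter> space M = E j" by (auto simp: E_def)
    finally show ?thesis .
  qed
  have F: "F j \<in> sets (vimage_algebra (space M) Z (count_space UNIV))" for j
  proof -
    have "Z -` {j} \<inter> space M \<in> sets (vimage_algebra (space M) Z (count_space UNIV))"
      by (intro in_vimage_algebra) auto
    also have "Z -` {j} \<inter> space M = F j" by (auto simp: F_def)
    finally show ?thesis .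
  qed
  have "{\<omega>\<in>space M. X \<omega> = x \<and> S \<omega> + Z \<omega> = k} = (\<Union>j\<le>k. E j \<inter> F (k - j))"
    by (auto simp: E_def F_def)
  also have "prob \<dots> = (\<Sum>j\<le>k. prob (E j \<inter> F (k - j)))"
  proof (rule finite_measure_finite_Union)
    show "(\<lambda>j. E j \<inter> F (k - j)) ` {..k} \<subseteq> events"
      using E F indep_setD_ev1[OF Z_indep] indep_setD_ev2[OF Z_indep] by blast
  qed (auto simp: disjoint_family_on_def E_def)
  also have "\<dots> = (\<Sum>j\<le>k. pmf P x * (pmf (poisson_law (\<epsilon> * x)) j * pmf N (k - j)))"
  proof (intro sum.cong refl)
    fix j
    have "prob (E j \<inter> F (k - j)) = prob (E j) * prob (F (k - j))"
      by (rule indep_setD[OF Z_indep E F])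
    then show "prob (E j \<inter> F (k - j)) = pmf P x * (pmf (poisson_law (\<epsilon> * x)) j * pmf N (k - j))"
      using XS[of j] Z_law[of "k - j"] by (simp add: E_def F_def)
  qed
  finally show "\<P>(\<omega> in M. X \<omega> = x \<and> S \<omega> + Z \<omega> = k) = pmf P x * output_prob N \<epsilon> x k"
    by (simp add: output_prob_def sum_distrib_left)
qed

lemma (in poisson_channel) mutual_information_eq_suminf:
  assumes "finite \<X>"
  shows "mutual_information (exp 1) (count_space \<X>) (count_space UNIV) X (\<lambda>\<omega>. S \<omega> + Z \<omega>)
       = (\<Sum>k. jensen_gap \<X> (pmf P) (\<lambda>x. output_prob N \<epsilon> x k))"
proof (rule sums_unique, rule mutual_information_sums_jensen_gap[OF assms X_measurable _ X_law])
  show "(\<lambda>\<omega>. S \<omega> + Z \<omega>) \<in> measurable M (count_space UNIV)"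
    using S_measurable Z_measurable by measurable
  show "output_prob N \<epsilon> x k \<ge> 0" for x k
    unfolding output_prob_def by (intro sum_nonneg mult_nonneg_nonneg) auto
qed (simp_all add: joint_law)

section \<open>Noisy channel\<close>

text \<open>With \<^term>\<open>S\<close> small, the output law is \<^term>\<open>N\<close> perturbed to first order by moving one count up,
  so \<^term>\<open>shift_ratio N k - 1\<close> is the score of the noise; the majorant dominates all orders at once.\<close>

definition shift_ratio :: "nat pmf \<Rightarrow> nat \<Rightarrow> real" where
  "shift_ratio N k = (if k = 0 then 0 else pmf N (k - 1) / pmf N k)"

definition shift_majorant :: "nat pmf \<Rightarrow> real \<Rightarrow> nat \<Rightarrow> real" where
  "shift_majorant N a k = (\<Sum>i<k. a ^ Suc i / fact (Suc i) * (pmf N (k - Suc i) / pmf N k))"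

text \<open>Splitting off the term with no signal count and factoring one \<epsilon> out of the rest
  exposes the first-order coefficient. The remaining powers \<open>\<epsilon> ^ i\<close> are at
  most 1 once \<open>\<epsilon> \<le> 1\<close>, which makes a majorant independent of \<epsilon>
  possible.\<close>

lemma output_prob_eq:
  assumes "\<epsilon> \<ge> 0" and "x \<ge> 0" and "pmf N k > 0"
  shows "output_prob N \<epsilon> x k = pmf N k * (exp (- (\<epsilon> * x)) *
           (1 + \<epsilon> * (\<Sum>i<k. \<epsilon> ^ i * (x ^ Suc i / fact (Suc i) * (pmf N (k - Suc i) / pmf N k)))))"
proof -
  have "output_prob N \<epsilon> x k = (\<Sum>j<Suc k. (\<epsilon> * x) ^ j / fact j * exp (- (\<epsilon> * x)) * pmf N (k - j))"
    using assms by (simp add: output_prob_def pmf_poisson_law lessThan_Suc_atMost)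
  also have "\<dots> = exp (- (\<epsilon> * x)) * pmf N k
      + (\<Sum>i<k. (\<epsilon> * x) ^ Suc i / fact (Suc i) * exp (- (\<epsilon> * x)) * pmf N (k - Suc i))"
    unfolding sum.lessThan_Suc_shift by (simp del: fact_Suc power_Suc)
  also have "(\<Sum>i<k. (\<epsilon> * x) ^ Suc i / fact (Suc i) * exp (- (\<epsilon> * x)) * pmf N (k - Suc i))
      = pmf N k * (exp (- (\<epsilon> * x)) *
           (\<epsilon> * (\<Sum>i<k. \<epsilon> ^ i * (x ^ Suc i / fact (Suc i) * (pmf N (k - Suc i) / pmf N k)))))"
    unfolding sum_distrib_left
    using assms(3) by (intro sum.cong refl) (simp add: power_mult_distrib field_simps del: fact_Suc)
  finally show ?thesis by (simp add: algebra_simps)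
qed

text \<open>At each \<open>k\<close> the first-order coefficient is a product of \<open>x\<close>
  and the score of the noise. The variance of the input therefore comes out of the series over
  \<open>k\<close>, and what remains is the Fisher information \<open>L\<close>.\<close>

lemma tendsto_noisy_information:
  assumes A: "finite A" "A \<subseteq> {0..a}"
    and p: "\<And>x. x \<in> A \<Longrightarrow> p x \<ge> 0" "sum p A = 1"
    and N: "\<And>k. pmf N k > 0" "summable (\<lambda>k. pmf N k * (shift_majorant N a k)\<^sup>2)"
    and L: "(\<lambda>k. pmf N k * (shift_ratio N k - 1)\<^sup>2) sums L"
  shows "((\<lambda>\<epsilon>. (\<Sum>k. jensen_gap A p (\<lambda>x. output_prob N \<epsilon> x k)) / \<epsilon>\<^sup>2) \<longlongrightarrow>
           1 / 2 * ((\<Sum>x\<in>A. p x * x\<^sup>2) - (\<Sum>x\<in>A. p x * x)\<^sup>2) * L) (at_right 0)"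
proof -
  define g where "g x k i = x ^ Suc i / fact (Suc i) * (pmf N (k - Suc i) / pmf N k)" for x k i
  define R where "R \<epsilon> x k = exp (- (\<epsilon> * x)) * (1 + \<epsilon> * (\<Sum>i<k. \<epsilon> ^ i * g x k i))" for \<epsilon> x k
  have g_nonneg: "g x k i \<ge> 0" if "x \<ge> 0" for x k i
    using that by (simp add: g_def del: fact_Suc)
  have R_nonneg: "R \<epsilon> x k \<ge> 0" if "x \<ge> 0" "\<epsilon> \<ge> 0" for \<epsilon> x k
    unfolding R_def using that g_nonneg[of x]
    by (intro mult_nonneg_nonneg add_nonneg_nonneg sum_nonneg) auto
  have gap: "jensen_gap A p (\<lambda>x. output_prob N \<epsilon> x k) = pmf N k * jensen_gap A p (\<lambda>x. R \<epsilon> x k)"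
    if "\<epsilon> \<ge> 0" for \<epsilon> k
  proof -
    have "output_prob N \<epsilon> x k = pmf N k * R \<epsilon> x k" if "x \<in> A" for x
      using that A \<open>\<epsilon> \<ge> 0\<close> N(1) by (auto simp: output_prob_eq R_def g_def simp del: fact_Suc)
    then have "jensen_gap A p (\<lambda>x. output_prob N \<epsilon> x k) = jensen_gap A p (\<lambda>x. pmf N k * R \<epsilon> x k)"
      unfolding jensen_gap_def by (intro arg_cong2[where f = "(-)"] arg_cong2[where f = "(*)"]
        arg_cong[where f = ln] sum.cong) auto
    also have "\<dots> = pmf N k * jensen_gap A p (\<lambda>x. R \<epsilon> x k)"
      using N(1) p(1) R_nonneg A that by (intro jensen_gap_mult) auto
    finally show ?thesis .
  qed
  have lim_R: "((\<lambda>\<epsilon>. (R \<epsilon> x k - 1) / \<epsilon>) \<longlongrightarrow> x * (shift_ratio N k - 1)) (at_right 0)" for x k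
  proof -
    have "((\<lambda>\<epsilon>. (exp (- (\<epsilon> * x)) - 1) / \<epsilon>) \<longlongrightarrow> - x) (at_right 0)"
      by real_asymp
    then have "((\<lambda>\<epsilon>. (exp (- (\<epsilon> * x)) - 1) / \<epsilon> + exp (- (\<epsilon> * x)) * (\<Sum>i<k. \<epsilon> ^ i * g x k i))
        \<longlongrightarrow> - x + exp (- (0 * x)) * (\<Sum>i<k. 0 ^ i * g x k i)) (at_right 0)"
      by (intro tendsto_intros)
    \<comment> \<open>Only \<open>i = 0\<close> survives because \<open>0 ^ 0 = 1\<close>. For
      \<open>k = 0\<close> the sum is empty, which matches the value 0 of \<open>shift_ratio\<close>
      there.\<close>
    also have "(\<Sum>i<k. 0 ^ i * g x k i) = x * shift_ratio N k"
      by (cases k) (simp_all add: shift_ratio_def sum.lessThan_Suc_shift g_def del: sum.lessThan_Suc)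
    finally have lim: "((\<lambda>\<epsilon>. (exp (- (\<epsilon> * x)) - 1) / \<epsilon> + exp (- (\<epsilon> * x)) * (\<Sum>i<k. \<epsilon> ^ i * g x k i))
        \<longlongrightarrow> x * (shift_ratio N k - 1)) (at_right 0)"
      by (simp add: algebra_simps)
    have "\<forall>\<^sub>F \<epsilon> in at_right 0. (exp (- (\<epsilon> * x)) - 1) / \<epsilon> + exp (- (\<epsilon> * x)) * (\<Sum>i<k. \<epsilon> ^ i * g x k i)
        = (R \<epsilon> x k - 1) / \<epsilon>"
      using eventually_at_right_less[of "0::real"] by eventually_elim (simp add: R_def field_simps)
    from Lim_transform_eventually[OF lim this] show ?thesis .
  qed
  \<comment> \<open>\<open>R \<epsilon> x k - 1\<close> is a loss of at most
    \<open>\<epsilon> * a\<close> from the exponential factor plus a gain of at most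
    \<open>\<epsilon> * shift_majorant N a k\<close> from positive signal counts.\<close>
  define b where "b k = a + shift_majorant N a k" for k
  have R_bound: "\<bar>R \<epsilon> x k - 1\<bar> \<le> \<epsilon> * b k" if "0 < \<epsilon>" "\<epsilon> \<le> 1" "x \<in> A" for \<epsilon> x k
  proof -
    have x: "0 \<le> x" "x \<le> a" using that A by auto
    define s where "s = (\<Sum>i<k. \<epsilon> ^ i * g x k i)"
    have s: "0 \<le> s"
      unfolding s_def using g_nonneg x that by (intro sum_nonneg) auto
    have "s \<le> (\<Sum>i<k. 1 * g a k i)"
      unfolding s_def g_def using x that
      by (intro sum_mono mult_mono divide_right_mono power_mono power_le_one) (auto simp del: fact_Suc power_Suc)
    then have s': "s \<le> shift_majorant N a k" by (simp add: g_def shift_majorant_def)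
    have e: "1 - \<epsilon> * x \<le> exp (- (\<epsilon> * x))" "exp (- (\<epsilon> * x)) \<le> 1"
      using exp_ge_add_one_self[of "- (\<epsilon> * x)"] x that by auto
    have "R \<epsilon> x k - 1 = exp (- (\<epsilon> * x)) - 1 + exp (- (\<epsilon> * x)) * (\<epsilon> * s)"
      by (simp add: R_def s_def algebra_simps)
    moreover have "0 \<le> exp (- (\<epsilon> * x)) * (\<epsilon> * s)" "exp (- (\<epsilon> * x)) * (\<epsilon> * s) \<le> \<epsilon> * s"
      using e s that by (auto intro: mult_left_le_one_le)
    moreover have "\<epsilon> * s \<le> \<epsilon> * shift_majorant N a k" "\<epsilon> * x \<le> \<epsilon> * a" "0 \<le> \<epsilon> * x" "0 \<le> \<epsilon> * s"
      using s s' x that by (auto intro: mult_left_mono)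
    ultimately show ?thesis
      unfolding b_def distrib_left abs_le_iff using e by linarith
  qed
  define c where "c k = pmf N k * (b k)\<^sup>2" for k
  have "summable c"
  proof (rule summable_comparison_test')
    show "summable (\<lambda>k. 2 * a\<^sup>2 * pmf N k + 2 * (pmf N k * (shift_majorant N a k)\<^sup>2))"
    proof -
      have "summable (pmf N)"
        using integrable_pmf[of UNIV N] by (simp add: integrable_count_space_nat_iff)
      then show ?thesis using N(2) by (intro summable_add summable_mult)
    qed
    show "norm (c k) \<le> 2 * a\<^sup>2 * pmf N k + 2 * (pmf N k * (shift_majorant N a k)\<^sup>2)" for k
    proof -
      have "(b k)\<^sup>2 \<le> 2 * a\<^sup>2 + 2 * (shift_majorant N a k)\<^sup>2"
        unfolding b_def using sum_squares_bound[of a "shift_majorant N a k"] by (simp add: power2_sum)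
      then have "pmf N k * (b k)\<^sup>2 \<le> pmf N k * (2 * a\<^sup>2 + 2 * (shift_majorant N a k)\<^sup>2)"
        by (intro mult_left_mono) auto
      then show ?thesis by (simp add: c_def algebra_simps)
    qed
  qed
  have lim: "((\<lambda>\<epsilon>. \<Sum>k. pmf N k * (jensen_gap A p (\<lambda>x. R \<epsilon> x k) / \<epsilon>\<^sup>2)) \<longlongrightarrow>
     (\<Sum>k. pmf N k * (((\<Sum>x\<in>A. p x * (x * (shift_ratio N k - 1))\<^sup>2)
        - (\<Sum>x\<in>A. p x * (x * (shift_ratio N k - 1)))\<^sup>2) / 2))) (at_right 0)"
  proof (rule tendsto_suminf_dominated)
    show "((\<lambda>\<epsilon>. pmf N k * (jensen_gap A p (\<lambda>x. R \<epsilon> x k) / \<epsilon>\<^sup>2)) \<longlongrightarrow>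
        pmf N k * (((\<Sum>x\<in>A. p x * (x * (shift_ratio N k - 1))\<^sup>2)
        - (\<Sum>x\<in>A. p x * (x * (shift_ratio N k - 1)))\<^sup>2) / 2)) (at_right 0)" for k
      by (intro tendsto_mult tendsto_const tendsto_jensen_gap p(2) lim_R)
    show "\<forall>\<^sub>F \<epsilon> in at_right 0. \<forall>k. \<bar>pmf N k * (jensen_gap A p (\<lambda>x. R \<epsilon> x k) / \<epsilon>\<^sup>2)\<bar> \<le> c k"
      using eventually_at_right_less[of "0::real"] eventually_at_right_real[of 0 "1::real", simplified]
    proof eventually_elim
      case (elim \<epsilon>)
      have "\<bar>jensen_gap A p (\<lambda>x. R \<epsilon> x k)\<bar> \<le> (\<epsilon> * b k)\<^sup>2" for k
        using elim A p by (intro jensen_gap_bound R_nonneg R_bound) auto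
      then show ?case
        using elim by (auto simp: c_def abs_mult power_mult_distrib field_simps intro!: mult_left_mono)
    qed
  qed (use \<open>summable c\<close> in auto)
  have "(\<Sum>k. pmf N k * (((\<Sum>x\<in>A. p x * (x * (shift_ratio N k - 1))\<^sup>2)
        - (\<Sum>x\<in>A. p x * (x * (shift_ratio N k - 1)))\<^sup>2) / 2))
     = (\<Sum>k. 1 / 2 * ((\<Sum>x\<in>A. p x * x\<^sup>2) - (\<Sum>x\<in>A. p x * x)\<^sup>2) * (pmf N k * (shift_ratio N k - 1)\<^sup>2))"
    by (simp add: power_mult_distrib mult.assoc[symmetric] flip: sum_distrib_right)
       (simp add: power_mult_distrib algebra_simps diff_divide_distrib)
  also have "\<dots> = 1 / 2 * ((\<Sum>x\<in>A. p x * x\<^sup>2) - (\<Sum>x\<in>A. p x * x)\<^sup>2) * L"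
    by (intro sums_unique[symmetric] sums_mult L)
  finally have lim_eq: "(\<Sum>k. pmf N k * (((\<Sum>x\<in>A. p x * (x * (shift_ratio N k - 1))\<^sup>2)
        - (\<Sum>x\<in>A. p x * (x * (shift_ratio N k - 1)))\<^sup>2) / 2))
     = 1 / 2 * ((\<Sum>x\<in>A. p x * x\<^sup>2) - (\<Sum>x\<in>A. p x * x)\<^sup>2) * L" .
  have "\<forall>\<^sub>F \<epsilon> in at_right 0. (\<Sum>k. pmf N k * (jensen_gap A p (\<lambda>x. R \<epsilon> x k) / \<epsilon>\<^sup>2))
      = (\<Sum>k. jensen_gap A p (\<lambda>x. output_prob N \<epsilon> x k)) / \<epsilon>\<^sup>2"
    using eventually_at_right_less[of "0::real"] eventually_at_right_real[of 0 "1::real", simplified]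
  proof eventually_elim
    case (elim \<epsilon>)
    \<comment> \<open>Taking the division by \<open>\<epsilon>^2\<close> out of the series requires
      summability at this fixed \<epsilon>; the majorant \<open>c\<close> provides it.\<close>
    have bound: "\<bar>pmf N k * jensen_gap A p (\<lambda>x. R \<epsilon> x k)\<bar> \<le> \<epsilon>\<^sup>2 * c k" for k
    proof -
      have "\<bar>jensen_gap A p (\<lambda>x. R \<epsilon> x k)\<bar> \<le> (\<epsilon> * b k)\<^sup>2"
        using elim A p by (intro jensen_gap_bound R_nonneg R_bound) auto
      then have "pmf N k * \<bar>jensen_gap A p (\<lambda>x. R \<epsilon> x k)\<bar> \<le> pmf N k * (\<epsilon> * b k)\<^sup>2"
        by (intro mult_left_mono) auto
      then show ?thesis by (simp add: c_def abs_mult power_mult_distrib mult_ac)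
    qed
    have "summable (\<lambda>k. pmf N k * jensen_gap A p (\<lambda>x. R \<epsilon> x k))"
      by (rule summable_comparison_test'[OF summable_mult[OF \<open>summable c\<close>, of "\<epsilon>\<^sup>2"], of 0])
         (use bound in simp)
    from suminf_divide[OF this, of "\<epsilon>\<^sup>2"] show ?case
      using elim by (simp add: gap)
  qed
  from Lim_transform_eventually[OF lim[unfolded lim_eq] this] show ?thesis .
qed

section \<open>Majorant and Fisher information of the two noise laws\<close>

lemma geometric_noise:
  assumes "e > 0"
  defines "N \<equiv> geometric_pmf (1 / (1 + e))"
  shows "pmf N k > 0"
    and "a \<ge> 0 \<Longrightarrow> summable (\<lambda>k. pmf N k * (shift_majorant N a k)\<^sup>2)"
    and "(\<lambda>k. pmf N k * (shift_ratio N k - 1)\<^sup>2) sums (1 / e)"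
proof -
  define b where "b = e / (1 + e)"
  have b: "0 < b" "b < 1" "1 / (1 + e) = 1 - b"
    using \<open>e > 0\<close> by (auto simp: b_def field_simps)
  have N: "pmf N k = b ^ k * (1 - b)" for k
    using b by (simp add: N_def)
  show "pmf N k > 0" using b by (simp add: N)
  have sums_N: "(\<lambda>k. pmf N k) sums 1"
    using sums_mult2[OF geometric_sums[of b], of "1 - b"] b by (simp add: N)
  {
    assume a: "a \<ge> 0"
    \<comment> \<open>Moving down by \<open>j\<close> counts multiplies the geometric weight by
      \<open>b ^ (- j)\<close>, whatever \<open>k\<close> is. The majorant is therefore a partial
      sum of the series of \<open>exp (a / b)\<close> without its constant term, bounded uniformly
      in \<open>k\<close>.\<close>
    have maj: "0 \<le> shift_majorant N a k" "shift_majorant N a k \<le> exp (a / b)" for k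
    proof -
      have "shift_majorant N a k = (\<Sum>i<k. (a / b) ^ Suc i / fact (Suc i))"
        unfolding shift_majorant_def
      proof (intro sum.cong refl)
        fix i assume "i \<in> {..<k}"
        then have "b ^ k = b ^ (k - Suc i) * b ^ Suc i"
          by (simp flip: power_add power_Suc)
        then show "a ^ Suc i / fact (Suc i) * (pmf N (k - Suc i) / pmf N k) = (a / b) ^ Suc i / fact (Suc i)"
          using b by (simp add: N power_divide field_simps del: fact_Suc power_Suc)
      qed
      also have "\<dots> = (\<Sum>i<Suc k. (a / b) ^ i / fact i) - 1"
        unfolding sum.lessThan_Suc_shift by (simp del: fact_Suc power_Suc)
      also have "\<dots> \<le> (\<Sum>i<Suc k. (a / b) ^ i / fact i)" by simp
      also have "\<dots> \<le> (\<Sum>i. (a / b) ^ i / fact i)"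
        using a b summable_exp[of "a / b"] by (intro sum_le_suminf) (auto simp: field_simps)
      also have "\<dots> = exp (a / b)"
        using exp_converges[of "a / b"] by (simp add: sums_iff divide_inverse mult_ac)
      finally show "shift_majorant N a k \<le> exp (a / b)" .
      show "0 \<le> shift_majorant N a k"
        unfolding shift_majorant_def using a by (intro sum_nonneg) (auto simp del: fact_Suc)
    qed
    show "summable (\<lambda>k. pmf N k * (shift_majorant N a k)\<^sup>2)"
    proof (rule summable_comparison_test')
      show "summable (\<lambda>k. pmf N k * (exp (a / b))\<^sup>2)"
        using sums_N by (intro summable_mult2) (simp add: sums_iff)
      show "norm (pmf N k * (shift_majorant N a k)\<^sup>2) \<le> pmf N k * (exp (a / b))\<^sup>2" for k
        using maj by (auto simp: abs_mult intro!: mult_left_mono power_mono)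
    qed
  }
  \<comment> \<open>The score is constant for positive counts. Only \<open>k = 0\<close>, where it
    is \<open>-1\<close>, has to be added separately.\<close>
  have step: "pmf N (Suc k) * (shift_ratio N (Suc k) - 1)\<^sup>2 = pmf N k * (b / e\<^sup>2)" for k
  proof -
    have "shift_ratio N (Suc k) - 1 = 1 / e"
      using \<open>e > 0\<close> b by (simp add: shift_ratio_def N) (simp add: b_def field_simps)
    then show ?thesis by (simp add: N power_divide)
  qed
  have "(\<lambda>k. pmf N (Suc k) * (shift_ratio N (Suc k) - 1)\<^sup>2) sums (1 * (b / e\<^sup>2))"
    unfolding step by (rule sums_mult2[OF sums_N])
  then have "(\<lambda>k. pmf N k * (shift_ratio N k - 1)\<^sup>2) sums (1 * (b / e\<^sup>2) + pmf N 0 * (shift_ratio N 0 - 1)\<^sup>2)"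
    by (rule sums_Suc)
  moreover have "1 * (b / e\<^sup>2) + pmf N 0 * (shift_ratio N 0 - 1)\<^sup>2 = 1 / e"
  proof -
    have "b / e\<^sup>2 = 1 / (e * (1 + e))"
      using \<open>e > 0\<close> by (simp add: b_def power2_eq_square)
    moreover have "pmf N 0 * (shift_ratio N 0 - 1)\<^sup>2 = 1 / (1 + e)"
      using b by (simp add: N shift_ratio_def)
    ultimately have "1 * (b / e\<^sup>2) + pmf N 0 * (shift_ratio N 0 - 1)\<^sup>2 = 1 / (e * (1 + e)) + 1 / (1 + e)"
      by simp
    also have "\<dots> = 1 / e" using \<open>e > 0\<close> by (simp add: divide_simps add_pos_pos)
    finally show ?thesis .
  qed
  ultimately show "(\<lambda>k. pmf N k * (shift_ratio N k - 1)\<^sup>2) sums (1 / e)" by simp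
qed

text \<open>Here the weight ratios turn the majorant into the binomial expansion of
  \<open>(1 + a / e) ^ k\<close> without its constant term. Its square grows geometrically in
  \<open>k\<close>, which \<open>fact k\<close> outweighs. The score is \<open>k / e - 1\<close>, so
  its second moment is the Poisson variance \<open>e\<close> divided by \<open>e^2\<close>.\<close>

lemma poisson_noise:
  assumes "e > 0"
  defines "N \<equiv> poisson_pmf e"
  shows "pmf N k > 0"
    and "a \<ge> 0 \<Longrightarrow> summable (\<lambda>k. pmf N k * (shift_majorant N a k)\<^sup>2)"
    and "(\<lambda>k. pmf N k * (shift_ratio N k - 1)\<^sup>2) sums (1 / e)"
proof -
  have N: "pmf N k = e ^ k / fact k * exp (- e)" for k
    using \<open>e > 0\<close> by (simp add: N_def)
  show "pmf N k > 0" using \<open>e > 0\<close> by (simp add: N)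
  have exp_sums: "(\<lambda>k. t ^ k / fact k) sums exp t" for t :: real
    using exp_converges[of t] by (simp add: divide_inverse mult_ac)
  {
    assume a: "a \<ge> 0"
    have maj: "0 \<le> shift_majorant N a k" "shift_majorant N a k \<le> (1 + a / e) ^ k" for k
    proof -
      have "shift_majorant N a k = (\<Sum>i<k. of_nat (k choose Suc i) * (a / e) ^ Suc i)"
        unfolding shift_majorant_def
      proof (intro sum.cong refl)
        fix i assume i: "i \<in> {..<k}"
        then have "e ^ k = e ^ (k - Suc i) * e ^ Suc i"
          by (simp flip: power_add power_Suc)
        moreover have "real (k choose Suc i) = fact k / (fact (Suc i) * fact (k - Suc i))"
          using i by (intro binomial_fact) auto
        ultimately show "a ^ Suc i / fact (Suc i) * (pmf N (k - Suc i) / pmf N k)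
            = of_nat (k choose Suc i) * (a / e) ^ Suc i"
          using \<open>e > 0\<close> by (simp add: N power_divide field_simps del: fact_Suc power_Suc binomial_Suc_Suc)
      qed
      also have "\<dots> = (\<Sum>i<Suc k. of_nat (k choose i) * (a / e) ^ i) - 1"
        unfolding sum.lessThan_Suc_shift by (simp del: power_Suc)
      also have "\<dots> \<le> (\<Sum>i<Suc k. of_nat (k choose i) * (a / e) ^ i)" by simp
      also have "\<dots> = (1 + a / e) ^ k"
        using binomial_ring[of "a / e" 1 k] by (simp add: lessThan_Suc_atMost add.commute)
      finally show "shift_majorant N a k \<le> (1 + a / e) ^ k" .
      show "0 \<le> shift_majorant N a k"
        unfolding shift_majorant_def using a by (intro sum_nonneg) (auto simp del: fact_Suc)
    qed
    show "summable (\<lambda>k. pmf N k * (shift_majorant N a k)\<^sup>2)"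
    proof (rule summable_comparison_test')
      show "summable (\<lambda>k. (e * (1 + a / e)\<^sup>2) ^ k / fact k * exp (- e))"
        using exp_sums by (intro summable_mult2) (simp add: sums_iff)
      show "norm (pmf N k * (shift_majorant N a k)\<^sup>2) \<le> (e * (1 + a / e)\<^sup>2) ^ k / fact k * exp (- e)" for k
      proof -
        have "pmf N k * (shift_majorant N a k)\<^sup>2 \<le> pmf N k * ((1 + a / e) ^ k)\<^sup>2"
          using maj by (intro mult_left_mono power_mono) auto
        also have "\<dots> = (e * (1 + a / e)\<^sup>2) ^ k / fact k * exp (- e)"
          by (simp add: N power_mult_distrib flip: power_mult) (simp add: mult.commute)
        finally show ?thesis by simp
      qed
    qed
  }
  have sums0: "(\<lambda>k. pmf N k) sums 1"
    using sums_mult2[OF exp_sums[of e], of "exp (- e)"] by (simp add: N flip: exp_add)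
  \<comment> \<open>This recursion and an index shift yield the moments \<open>e\<close> and
    \<open>e * (e + 1)\<close> from the total mass.\<close>
  have step: "real (Suc k) * pmf N (Suc k) = e * pmf N k" for k
    by (simp add: N del: of_nat_Suc)
  have "(\<lambda>k. real (Suc k) * pmf N (Suc k)) sums e"
    using sums_mult[OF sums0, of e] by (simp only: step mult_1_right)
  from sums_Suc[OF this] have sums1: "(\<lambda>k. real k * pmf N k) sums e"
    by simp
  have "(\<lambda>k. real (Suc k) * (real (Suc k) * pmf N (Suc k))) sums (e * (e + 1))"
    using sums_mult[OF sums_add[OF sums1 sums0], of e] by (simp only: step) (simp add: algebra_simps)
  from sums_Suc[OF this] have sums2: "(\<lambda>k. real k * (real k * pmf N k)) sums (e * (e + 1))"
    by simp
  have ratio: "shift_ratio N k = real k / e" for k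
    using \<open>e > 0\<close> by (cases k) (simp_all add: shift_ratio_def N field_simps)
  have "(\<lambda>k. 1 / e\<^sup>2 * (real k * (real k * pmf N k)) - 2 / e * (real k * pmf N k) + pmf N k)
      sums (1 / e\<^sup>2 * (e * (e + 1)) - 2 / e * e + 1)"
    by (intro sums_add sums_diff sums_mult sums0 sums1 sums2)
  moreover have "1 / e\<^sup>2 * (e * (e + 1)) - 2 / e * e + 1 = 1 / e"
    using \<open>e > 0\<close> by (simp add: field_simps power2_eq_square)
  moreover have "1 / e\<^sup>2 * (real k * (real k * pmf N k)) - 2 / e * (real k * pmf N k) + pmf N k
      = pmf N k * (shift_ratio N k - 1)\<^sup>2" for k
    using \<open>e > 0\<close> by (simp add: ratio power2_diff power_divide) (simp add: power2_eq_square algebra_simps)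
  ultimately show "(\<lambda>k. pmf N k * (shift_ratio N k - 1)\<^sup>2) sums (1 / e)" by simp
qed

section \<open>Noiseless channel\<close>

lemma output_prob_noiseless:
  assumes "\<epsilon> \<ge> 0" and "x \<ge> 0"
  shows "output_prob (return_pmf 0) \<epsilon> x k = \<epsilon> ^ k / fact k * (exp (- (\<epsilon> * x)) * x ^ k)"
proof -
  have "output_prob (return_pmf 0) \<epsilon> x k
      = (\<Sum>j\<le>k. if j = k then pmf (poisson_law (\<epsilon> * x)) j else 0)"
    unfolding output_prob_def by (intro sum.cong) (auto simp: indicator_def)
  then show ?thesis
    using assms by (simp add: pmf_poisson_law power_mult_distrib)
qed

lemma tendsto_noiseless_information:
  fixes A :: "real set" and p :: "real \<Rightarrow> real"
  assumes A: "finite A" "A \<subseteq> {0..a}"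
    and p: "\<And>x. x \<in> A \<Longrightarrow> p x \<ge> 0" "sum p A = 1"
    and m1: "m\<^sub>1 = (\<Sum>x\<in>A. p x * x)" "m\<^sub>1 > 0" and m2: "m\<^sub>2 = (\<Sum>x\<in>A. p x * x\<^sup>2)"
  shows "((\<lambda>\<epsilon>. ((\<Sum>k. jensen_gap A p (\<lambda>x. output_prob (return_pmf 0) \<epsilon> x k))
             - (\<Sum>x\<in>A. p x * (x * ln (x / m\<^sub>1))) * \<epsilon>) / \<epsilon>\<^sup>2) \<longlongrightarrow>
           1 / 2 * (m\<^sub>2 - m\<^sub>1\<^sup>2 - m\<^sub>2 * ln (m\<^sub>2 / m\<^sub>1\<^sup>2))) (at_right 0)"
proof -
  define D where "D k \<epsilon> = jensen_gap A p (\<lambda>x. exp (- (\<epsilon> * x)) * x ^ k)" for k \<epsilon>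
  define mean where "mean k \<epsilon> = (\<Sum>x\<in>A. p x * (exp (- (\<epsilon> * x)) * x ^ k))" for k \<epsilon>
  \<comment> \<open>Each half of the gap is built from values of \<open>t * ln t\<close> with
    \<open>t\<close> between 0 and \<open>a ^ k\<close>, hence is at most
    \<open>1 + (a ^ k)^2\<close>; the factor 2 counts the halves.\<close>
  define c where "c k = 2 * (1 + (a ^ k)\<^sup>2)" for k
  have x: "0 \<le> x" "x \<le> a" if "x \<in> A" for x using A that by auto
  have D_eq: "D k \<epsilon> = (\<Sum>x\<in>A. p x * ((exp (- (\<epsilon> * x)) * x ^ k) * ln (exp (- (\<epsilon> * x)) * x ^ k)))
      - mean k \<epsilon> * ln (mean k \<epsilon>)" for k \<epsilon>
    by (simp add: D_def mean_def jensen_gap_def)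

  \<comment> \<open>A positive input of positive probability keeps every mean strictly positive, so
    \<open>ln\<close> of the mean is continuous and differentiable in \<epsilon>.\<close>
  obtain y where y: "y \<in> A" "p y > 0" "y > 0"
  proof -
    have "(\<Sum>x\<in>A. p x * x) \<noteq> 0" using m1 by simp
    then obtain y where "y \<in> A" "p y * y \<noteq> 0" by (rule sum.not_neutral_contains_not_neutral)
    with p(1)[of y] x[of y] that show thesis by (auto simp: less_le)
  qed
  have mean_pos: "mean k \<epsilon> > 0" for k \<epsilon>
    unfolding mean_def using A y p(1) x by (intro sum_pos2[where i = y]) auto

  have gap: "jensen_gap A p (\<lambda>x. output_prob (return_pmf 0) \<epsilon> x k) = \<epsilon> ^ k / fact k * D k \<epsilon>"
    if "\<epsilon> > 0" for \<epsilon> k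
  proof -
    have "jensen_gap A p (\<lambda>x. output_prob (return_pmf 0) \<epsilon> x k)
        = jensen_gap A p (\<lambda>x. \<epsilon> ^ k / fact k * (exp (- (\<epsilon> * x)) * x ^ k))"
      unfolding jensen_gap_def using that x
      by (intro arg_cong2[where f = "(-)"] arg_cong2[where f = "(*)"] arg_cong[where f = ln] sum.cong)
         (auto simp: output_prob_noiseless)
    also have "\<dots> = \<epsilon> ^ k / fact k * D k \<epsilon>"
      unfolding D_def using that p(1) x by (intro jensen_gap_mult) auto
    finally show ?thesis .
  qed

  have D_bound: "\<bar>D k \<epsilon>\<bar> \<le> c k" if "\<epsilon> \<ge> 0" for k \<epsilon>
  proof -
    have w: "0 \<le> exp (- (\<epsilon> * x)) * x ^ k" "exp (- (\<epsilon> * x)) * x ^ k \<le> a ^ k" if "x \<in> A" for x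
    proof -
      have "exp (- (\<epsilon> * x)) * x ^ k \<le> 1 * a ^ k"
        using x[OF that] \<open>\<epsilon> \<ge> 0\<close> by (intro mult_mono power_mono) auto
      then show "exp (- (\<epsilon> * x)) * x ^ k \<le> a ^ k" by simp
    qed (use x[OF that] in simp)
    have xlnx: "\<bar>t * ln t\<bar> \<le> 1 + (a ^ k)\<^sup>2" if "0 \<le> t" "t \<le> a ^ k" for t
      using abs_xlnx_le[of t] power_mono[of t "a ^ k" 2] that by linarith
    have "mean k \<epsilon> \<le> (\<Sum>x\<in>A. p x * a ^ k)"
      unfolding mean_def using p(1) w by (intro sum_mono mult_left_mono) auto
    then have "mean k \<epsilon> \<le> a ^ k" using p(2) by (simp flip: sum_distrib_right)
    then have mean_le: "\<bar>mean k \<epsilon> * ln (mean k \<epsilon>)\<bar> \<le> 1 + (a ^ k)\<^sup>2"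
      using mean_pos[of k \<epsilon>] by (intro xlnx) auto
    have "\<bar>\<Sum>x\<in>A. p x * ((exp (- (\<epsilon> * x)) * x ^ k) * ln (exp (- (\<epsilon> * x)) * x ^ k))\<bar>
        \<le> (\<Sum>x\<in>A. p x * (1 + (a ^ k)\<^sup>2))"
      using p(1) xlnx[OF w]
      by (intro order.trans[OF sum_abs] sum_mono) (simp add: abs_mult[of "p _"] mult_left_mono)
    also have "\<dots> = 1 + (a ^ k)\<^sup>2"
      using p(2) by (simp flip: sum_distrib_right)
    finally have "\<bar>D k \<epsilon>\<bar> \<le> (1 + (a ^ k)\<^sup>2) + (1 + (a ^ k)\<^sup>2)"
      unfolding D_eq by (rule order.trans[OF abs_triangle_ineq4 add_mono[OF _ mean_le]])
    then show ?thesis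
      by (simp add: c_def)
  qed
  have summable_c: "summable (\<lambda>k. c k / fact k)"
  proof -
    have "summable (\<lambda>k. 2 * (1 ^ k /\<^sub>R fact k) + 2 * ((a\<^sup>2) ^ k /\<^sub>R fact k))"
      by (intro summable_add summable_mult summable_exp_generic)
    then show ?thesis
      by (simp add: c_def divide_inverse algebra_simps flip: power_mult)
  qed
  have summable_D: "summable (\<lambda>k. \<epsilon> ^ k / fact k * D k \<epsilon>)" if "0 \<le> \<epsilon>" "\<epsilon> \<le> 1" for \<epsilon>
  proof (rule summable_comparison_test'[OF summable_c])
    fix k
    have "\<epsilon> ^ k * \<bar>D k \<epsilon>\<bar> \<le> 1 * c k"
      using that D_bound by (intro mult_mono power_le_one) auto
    then show "norm (\<epsilon> ^ k / fact k * D k \<epsilon>) \<le> c k / fact k"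
      using that by (simp add: abs_mult divide_right_mono)
  qed

  have lim_mean: "(mean k \<longlongrightarrow> mean k 0) (at_right 0)" for k
    unfolding mean_def by (intro tendsto_intros)
  have lim_D: "(D k \<longlongrightarrow> D k 0) (at_right 0)" for k
    unfolding D_eq
  proof (intro tendsto_diff tendsto_sum tendsto_mult tendsto_const lim_mean)
    fix x :: real
    show "((\<lambda>\<epsilon>. exp (- (\<epsilon> * x))) \<longlongrightarrow> exp (- (0 * x))) (at_right 0)"
      by (intro tendsto_intros)
    \<comment> \<open>When \<open>x ^ k = 0\<close> the argument of \<open>ln\<close> is 0 for every
      \<epsilon>, so the function is constant and continuity of \<open>ln\<close> at 0 is never
      invoked.\<close>
    show "((\<lambda>\<epsilon>. ln (exp (- (\<epsilon> * x)) * x ^ k)) \<longlongrightarrow> ln (exp (- (0 * x)) * x ^ k)) (at_right 0)"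
      by (cases "x ^ k = 0", simp, intro tendsto_intros) auto
    show "((\<lambda>\<epsilon>. ln (mean k \<epsilon>)) \<longlongrightarrow> ln (mean k 0)) (at_right 0)"
      using mean_pos[of k 0] by (intro tendsto_ln lim_mean) simp
  qed

  have lim0: "((\<lambda>\<epsilon>. D 0 \<epsilon> / \<epsilon>\<^sup>2) \<longlongrightarrow> (m\<^sub>2 - m\<^sub>1\<^sup>2) / 2) (at_right 0)"
  proof -
    have "((\<lambda>\<epsilon>. (exp (- (\<epsilon> * x)) * x ^ 0 - 1) / \<epsilon>) \<longlongrightarrow> - x) (at_right 0)" for x :: real
      by (simp, real_asymp)
    from tendsto_jensen_gap[OF p(2) this] show ?thesis
      by (simp add: D_def m1 m2 sum_negf)
  qed

  \<comment> \<open>The derivative of \<open>D 1\<close> at 0. As \<open>t * ln t\<close> has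
    derivative \<open>ln t + 1\<close>, the two \<open>+ 1\<close> parts each contribute
    \<open>- m\<^sub>2\<close> and cancel.\<close>
  define d where "d = m\<^sub>2 * ln m\<^sub>1 - (\<Sum>x\<in>A. p x * (x\<^sup>2 * ln x))"
  have lim1: "((\<lambda>\<epsilon>. (D 1 \<epsilon> - D 1 0) / \<epsilon>) \<longlongrightarrow> d) (at_right 0)"
  proof -
    \<comment> \<open>With the logarithm split, every summand is differentiable in \<epsilon>; at
      \<open>x = 0\<close> the outer factor \<open>x\<close> makes both forms 0.\<close>
    have D1: "D 1 = (\<lambda>\<epsilon>. (\<Sum>x\<in>A. p x * (exp (- (\<epsilon> * x)) * x * (ln x - \<epsilon> * x))) - mean 1 \<epsilon> * ln (mean 1 \<epsilon>))"
    proof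
      fix \<epsilon>
      have "exp (- (\<epsilon> * x)) * x * ln (exp (- (\<epsilon> * x)) * x) = exp (- (\<epsilon> * x)) * x * (ln x - \<epsilon> * x)"
        if "x \<in> A" for x
        using x[OF that] by (cases "x = 0") (auto simp: ln_mult)
      then show "D 1 \<epsilon> = (\<Sum>x\<in>A. p x * (exp (- (\<epsilon> * x)) * x * (ln x - \<epsilon> * x))) - mean 1 \<epsilon> * ln (mean 1 \<epsilon>)"
        unfolding D_eq by (intro arg_cong2[where f = "(-)"] sum.cong) auto
    qed
    have mean0: "mean 1 0 = m\<^sub>1" by (simp add: mean_def m1)
    have mean': "(mean 1 has_real_derivative (\<Sum>x\<in>A. p x * (- (x * x)))) (at 0)"
      unfolding mean_def by (auto intro!: derivative_eq_intros sum.cong)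
    have "(D 1 has_real_derivative
        (\<Sum>x\<in>A. p x * (- (x * x) * ln x - x * x)) -
        ((\<Sum>x\<in>A. p x * (- (x * x))) * ln m\<^sub>1 + (\<Sum>x\<in>A. p x * (- (x * x))))) (at 0)"
      unfolding D1
    proof (rule DERIV_diff)
      show "((\<lambda>\<epsilon>. \<Sum>x\<in>A. p x * (exp (- (\<epsilon> * x)) * x * (ln x - \<epsilon> * x))) has_real_derivative
          (\<Sum>x\<in>A. p x * (- (x * x) * ln x - x * x))) (at 0)"
        by (auto intro!: derivative_eq_intros sum.cong simp: algebra_simps)
      have "((\<lambda>\<epsilon>. ln (mean 1 \<epsilon>)) has_real_derivative 1 / m\<^sub>1 * (\<Sum>x\<in>A. p x * (- (x * x)))) (at 0)"
        using DERIV_chain2[OF _ mean', of ln "1 / m\<^sub>1"] m1(2) mean0 by (auto intro: DERIV_ln_divide)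
      from DERIV_mult[OF mean' this] mean0 m1(2)
      show "((\<lambda>\<epsilon>. mean 1 \<epsilon> * ln (mean 1 \<epsilon>)) has_real_derivative
          (\<Sum>x\<in>A. p x * (- (x * x))) * ln m\<^sub>1 + (\<Sum>x\<in>A. p x * (- (x * x)))) (at 0)"
        by (simp add: add.commute)
    qed
    also have "(\<Sum>x\<in>A. p x * (- (x * x) * ln x - x * x)) -
        ((\<Sum>x\<in>A. p x * (- (x * x))) * ln m\<^sub>1 + (\<Sum>x\<in>A. p x * (- (x * x)))) = d"
      by (simp add: d_def m2 power2_eq_square sum_negf sum_subtractf right_diff_distrib)
    finally have "(\<lambda>\<epsilon>. (D 1 \<epsilon> - D 1 0) / \<epsilon>) \<midarrow>0\<rightarrow> d"
      by (simp add: DERIV_def)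
    then show ?thesis by (rule tendsto_mono[rotated]) (simp add: at_le)
  qed

  have lim2: "((\<lambda>\<epsilon>. \<Sum>k. \<epsilon> ^ k / fact (k + 2) * D (k + 2) \<epsilon>) \<longlongrightarrow> D 2 0 / 2) (at_right 0)"
  proof -
    have "((\<lambda>\<epsilon>. \<Sum>k. \<epsilon> ^ k / fact (k + 2) * D (k + 2) \<epsilon>) \<longlongrightarrow>
        (\<Sum>k. 0 ^ k / fact (k + 2) * D (k + 2) 0)) (at_right 0)"
    proof (rule tendsto_suminf_dominated)
      show "((\<lambda>\<epsilon>. \<epsilon> ^ k / fact (k + 2) * D (k + 2) \<epsilon>) \<longlongrightarrow> 0 ^ k / fact (k + 2) * D (k + 2) 0) (at_right 0)" for k
        by (intro tendsto_intros lim_D) auto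
      show "\<forall>\<^sub>F \<epsilon> in at_right 0. \<forall>k. \<bar>\<epsilon> ^ k / fact (k + 2) * D (k + 2) \<epsilon>\<bar> \<le> c (k + 2) / fact (k + 2)"
        using eventually_at_right_real[of 0 "1::real", simplified]
      proof eventually_elim
        case (elim \<epsilon>)
        have "\<epsilon> ^ k * \<bar>D (k + 2) \<epsilon>\<bar> \<le> 1 * c (k + 2)" for k
          using elim D_bound by (intro mult_mono power_le_one) auto
        then show ?case
          using elim by (auto simp: abs_mult divide_right_mono simp del: fact_Suc add_2_eq_Suc')
      qed
      show "summable (\<lambda>k. c (k + 2) / fact (k + 2))"
        by (rule summable_ignore_initial_segment[OF summable_c])
    qed auto
    also have "(\<Sum>k. 0 ^ k / fact (k + 2) * D (k + 2) 0) = (\<Sum>k\<in>{0}. 0 ^ k / fact (k + 2) * D (k + 2) 0)"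
      by (intro suminf_finite) auto
    also have "\<dots> = D 2 0 / 2" by (simp add: numeral_2_eq_2)
    finally show ?thesis .
  qed

  have lim: "((\<lambda>\<epsilon>. D 0 \<epsilon> / \<epsilon>\<^sup>2 + (D 1 \<epsilon> - D 1 0) / \<epsilon> + (\<Sum>k. \<epsilon> ^ k / fact (k + 2) * D (k + 2) \<epsilon>))
      \<longlongrightarrow> (m\<^sub>2 - m\<^sub>1\<^sup>2) / 2 + d + D 2 0 / 2) (at_right 0)"
    by (intro tendsto_add lim0 lim1 lim2)

  have D10: "D 1 0 = (\<Sum>x\<in>A. p x * (x * ln (x / m\<^sub>1)))"
  proof -
    have "p x * (x * ln (x / m\<^sub>1)) = p x * (x * ln x) - p x * x * ln m\<^sub>1" if "x \<in> A" for x
      using x[OF that] m1(2) by (cases "x = 0") (auto simp: ln_div algebra_simps)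
    then show ?thesis
      by (simp add: D_def jensen_gap_def sum_subtractf sum_distrib_right flip: m1(1))
         (simp add: m1(1) sum_distrib_right)
  qed
  have D20: "D 2 0 = 2 * (\<Sum>x\<in>A. p x * (x\<^sup>2 * ln x)) - m\<^sub>2 * ln m\<^sub>2"
  proof -
    have "x\<^sup>2 * ln (x\<^sup>2) = 2 * (x\<^sup>2 * ln x)" if "x \<in> A" for x
      using x[OF that] by (cases "x = 0") (auto simp: ln_realpow)
    then have "(\<Sum>x\<in>A. p x * (x\<^sup>2 * ln (x\<^sup>2))) = (\<Sum>x\<in>A. p x * (2 * (x\<^sup>2 * ln x)))"
      by (intro sum.cong) auto
    then show ?thesis
      by (simp add: D_def jensen_gap_def m2 sum_distrib_left mult.left_commute)
  qed
  have m2_pos: "m\<^sub>2 > 0"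
    using mean_pos[of 2 0] by (simp add: mean_def m2)
  \<comment> \<open>The sums of \<open>p x * (x^2 * ln x)\<close> cancel between \<open>d\<close>
    and \<open>D 2 0 / 2\<close>. What is left,
    \<open>m\<^sub>2 * ln m\<^sub>1 - m\<^sub>2 * ln m\<^sub>2 / 2\<close>, is the logarithmic part
    of the coefficient.\<close>
  have "(m\<^sub>2 - m\<^sub>1\<^sup>2) / 2 + d + D 2 0 / 2 = 1 / 2 * (m\<^sub>2 - m\<^sub>1\<^sup>2 - m\<^sub>2 * ln (m\<^sub>2 / m\<^sub>1\<^sup>2))"
    using m1(2) m2_pos by (simp add: D20 d_def ln_div ln_realpow field_simps)
  note lim = lim[unfolded this]

  \<comment> \<open>The subtracted linear term is exactly \<open>D 1 0 * \<epsilon>\<close>, which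
    turns the contribution of \<open>k = 1\<close> into a difference quotient.\<close>
  have "\<forall>\<^sub>F \<epsilon> in at_right 0.
      D 0 \<epsilon> / \<epsilon>\<^sup>2 + (D 1 \<epsilon> - D 1 0) / \<epsilon> + (\<Sum>k. \<epsilon> ^ k / fact (k + 2) * D (k + 2) \<epsilon>)
      = ((\<Sum>k. jensen_gap A p (\<lambda>x. output_prob (return_pmf 0) \<epsilon> x k))
             - (\<Sum>x\<in>A. p x * (x * ln (x / m\<^sub>1))) * \<epsilon>) / \<epsilon>\<^sup>2"
    using eventually_at_right_real[of 0 "1::real", simplified]
  proof eventually_elim
    case (elim \<epsilon>)
    have "(\<Sum>k. \<epsilon> ^ k / fact (k + 2) * D (k + 2) \<epsilon>) * \<epsilon>\<^sup>2
        = (\<Sum>k. \<epsilon> ^ (k + 2) / fact (k + 2) * D (k + 2) \<epsilon>)"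
    proof (subst suminf_mult2)
      have "summable (\<lambda>k. \<epsilon> ^ (k + 2) / fact (k + 2) * D (k + 2) \<epsilon>)"
        using elim by (intro summable_ignore_initial_segment summable_D) auto
      from summable_divide[OF this, of "\<epsilon>\<^sup>2"]
      show "summable (\<lambda>k. \<epsilon> ^ k / fact (k + 2) * D (k + 2) \<epsilon>)"
        using elim by (simp add: power_add power2_eq_square del: fact_Suc add_2_eq_Suc')
    qed (simp add: power_add mult_ac power2_eq_square del: fact_Suc add_2_eq_Suc')
    also have "\<dots> = (\<Sum>k. \<epsilon> ^ k / fact k * D k \<epsilon>) - (\<Sum>k<2. \<epsilon> ^ k / fact k * D k \<epsilon>)"
      using elim by (intro suminf_minus_initial_segment summable_D) auto
    also have "(\<Sum>k. \<epsilon> ^ k / fact k * D k \<epsilon>) = (\<Sum>k. jensen_gap A p (\<lambda>x. output_prob (return_pmf 0) \<epsilon> x k))"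
      using elim by (simp add: gap)
    also have "(\<Sum>k<2. \<epsilon> ^ k / fact k * D k \<epsilon>) = D 0 \<epsilon> + \<epsilon> * D 1 \<epsilon>"
      by (simp add: numeral_2_eq_2)
    finally have "(\<Sum>k. \<epsilon> ^ k / fact (k + 2) * D (k + 2) \<epsilon>)
        = ((\<Sum>k. jensen_gap A p (\<lambda>x. output_prob (return_pmf 0) \<epsilon> x k)) - (D 0 \<epsilon> + \<epsilon> * D 1 \<epsilon>)) / \<epsilon>\<^sup>2"
      using elim by (simp add: eq_divide_eq)
    then show ?case
      using elim by (simp add: D10[symmetric] diff_divide_distrib add_divide_distrib power2_eq_square)
  qed
  from Lim_transform_eventually[OF lim this] show ?thesis .
qed

section \<open>Low-intensity expansion\<close>

theorem theorem3:
  fixes \<X> :: "real set" and P :: "real pmf" and N :: "nat pmf" and \<mu>\<^sub>1 \<mu>\<^sub>2 :: real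
    and M :: "real \<Rightarrow> 'w measure" and X :: "real \<Rightarrow> 'w \<Rightarrow> real" and S Z :: "real \<Rightarrow> 'w \<Rightarrow> nat"
    and I :: "real \<Rightarrow> real"
  assumes "finite \<X>" and "\<X> \<subseteq> {0..}" and "set_pmf P \<subseteq> \<X>"
    and "\<mu>\<^sub>1 = (\<Sum>x\<in>\<X>. pmf P x * x)" and "\<mu>\<^sub>2 = (\<Sum>x\<in>\<X>. pmf P x * x\<^sup>2)" and "\<mu>\<^sub>1 > 0"
    and "\<And>\<epsilon>. \<epsilon> > 0 \<Longrightarrow> poisson_channel (M \<epsilon>) \<X> P N \<epsilon> (X \<epsilon>) (S \<epsilon>) (Z \<epsilon>)"
    and "\<And>\<epsilon>. \<epsilon> > 0 \<Longrightarrow>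
           I \<epsilon> = prob_space.mutual_information (M \<epsilon>) (exp 1) (count_space \<X>) (count_space UNIV)
                   (X \<epsilon>) (\<lambda>\<omega>. S \<epsilon> \<omega> + Z \<epsilon> \<omega>)"
  shows "(N = return_pmf 0 \<longrightarrow>
           (\<lambda>\<epsilon>. I \<epsilon> - ((\<Sum>x\<in>\<X>. pmf P x * (x * ln (x / \<mu>\<^sub>1))) * \<epsilon>
                     + 1 / 2 * (\<mu>\<^sub>2 - \<mu>\<^sub>1\<^sup>2 - \<mu>\<^sub>2 * ln (\<mu>\<^sub>2 / \<mu>\<^sub>1\<^sup>2)) * \<epsilon>\<^sup>2))
             \<in> o[at_right 0](\<lambda>\<epsilon>. \<epsilon>\<^sup>2)) \<and>
         (\<forall>\<epsilon>\<^sub>n>0. N = poisson_pmf \<epsilon>\<^sub>n \<or> N = geometric_pmf (1 / (1 + \<epsilon>\<^sub>n)) \<longrightarrow>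
           (\<lambda>\<epsilon>. I \<epsilon> - (0 * \<epsilon> + 1 / 2 * ((\<mu>\<^sub>2 - \<mu>\<^sub>1\<^sup>2) / \<epsilon>\<^sub>n) * \<epsilon>\<^sup>2))
             \<in> o[at_right 0](\<lambda>\<epsilon>. \<epsilon>\<^sup>2))"
proof -
  define J where "J \<epsilon> = (\<Sum>k. jensen_gap \<X> (pmf P) (\<lambda>x. output_prob N \<epsilon> x k))" for \<epsilon>
  define a where "a = Max (insert 0 \<X>)"
  have a: "\<X> \<subseteq> {0..a}" "a \<ge> 0"
    using assms(1,2) by (auto simp: a_def intro!: Max_ge)
  have sum_P: "sum (pmf P) \<X> = 1"
    using assms(1,3) by (rule sum_pmf_eq_1)
  have I_eq: "I \<epsilon> = J \<epsilon>" if "\<epsilon> > 0" for \<epsilon>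
    unfolding J_def assms(8)[OF that]
    by (rule poisson_channel.mutual_information_eq_suminf[OF assms(7)[OF that] assms(1)])
  \<comment> \<open>Both cases reduce to one limit for the series \<open>J\<close>. It agrees with
    \<open>I\<close> for \<open>\<epsilon> > 0\<close>, which is all that \<open>at_right 0\<close>
    sees, and it involves no probability space, so the spaces \<open>M \<epsilon>\<close> may vary
    with \<epsilon>.\<close>
  have smallo: "(\<lambda>\<epsilon>. I \<epsilon> - (c\<^sub>1 * \<epsilon> + c\<^sub>2 * \<epsilon>\<^sup>2)) \<in> o[at_right 0](\<lambda>\<epsilon>. \<epsilon>\<^sup>2)"
    if "((\<lambda>\<epsilon>. (J \<epsilon> - c\<^sub>1 * \<epsilon>) / \<epsilon>\<^sup>2) \<longlongrightarrow> c\<^sub>2) (at_right 0)" for c\<^sub>1 c\<^sub>2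
  proof (rule smalloI_tendsto)
    have "((\<lambda>\<epsilon>. (J \<epsilon> - c\<^sub>1 * \<epsilon>) / \<epsilon>\<^sup>2 - c\<^sub>2) \<longlongrightarrow> 0) (at_right 0)"
      using that by (simp add: LIM_zero)
    moreover have "\<forall>\<^sub>F \<epsilon> in at_right 0.
        (J \<epsilon> - c\<^sub>1 * \<epsilon>) / \<epsilon>\<^sup>2 - c\<^sub>2 = (I \<epsilon> - (c\<^sub>1 * \<epsilon> + c\<^sub>2 * \<epsilon>\<^sup>2)) / \<epsilon>\<^sup>2"
      using eventually_at_right_less[of "0::real"]
      by eventually_elim (simp add: I_eq field_simps)
    ultimately show "((\<lambda>\<epsilon>. (I \<epsilon> - (c\<^sub>1 * \<epsilon> + c\<^sub>2 * \<epsilon>\<^sup>2)) / \<epsilon>\<^sup>2) \<longlongrightarrow> 0) (at_right 0)"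
      by (rule Lim_transform_eventually)
    show "\<forall>\<^sub>F \<epsilon> in at_right 0. \<epsilon>\<^sup>2 \<noteq> (0 :: real)"
      by (auto simp: eventually_at_filter)
  qed
  show ?thesis
  proof (intro conjI impI allI)
    assume "N = return_pmf 0"
    then show "(\<lambda>\<epsilon>. I \<epsilon> - ((\<Sum>x\<in>\<X>. pmf P x * (x * ln (x / \<mu>\<^sub>1))) * \<epsilon>
                     + 1 / 2 * (\<mu>\<^sub>2 - \<mu>\<^sub>1\<^sup>2 - \<mu>\<^sub>2 * ln (\<mu>\<^sub>2 / \<mu>\<^sub>1\<^sup>2)) * \<epsilon>\<^sup>2))
             \<in> o[at_right 0](\<lambda>\<epsilon>. \<epsilon>\<^sup>2)"
      using tendsto_noiseless_information[OF assms(1) a(1) _ sum_P assms(4,6,5)]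
      by (intro smallo) (simp add: J_def)
  next
    fix e :: real assume e: "e > 0" and N: "N = poisson_pmf e \<or> N = geometric_pmf (1 / (1 + e))"
    have "pmf N k > 0" for k
      using N poisson_noise(1)[OF e] geometric_noise(1)[OF e] by auto
    moreover have "summable (\<lambda>k. pmf N k * (shift_majorant N a k)\<^sup>2)"
      using N poisson_noise(2)[OF e a(2)] geometric_noise(2)[OF e a(2)] by auto
    moreover have "(\<lambda>k. pmf N k * (shift_ratio N k - 1)\<^sup>2) sums (1 / e)"
      using N poisson_noise(3)[OF e] geometric_noise(3)[OF e] by auto
    ultimately have "((\<lambda>\<epsilon>. J \<epsilon> / \<epsilon>\<^sup>2) \<longlongrightarrow> 1 / 2 * (\<mu>\<^sub>2 - \<mu>\<^sub>1\<^sup>2) * (1 / e)) (at_right 0)"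
      unfolding J_def assms(4,5)
      using assms(1) a(1) sum_P by (intro tendsto_noisy_information) auto
    then show "(\<lambda>\<epsilon>. I \<epsilon> - (0 * \<epsilon> + 1 / 2 * ((\<mu>\<^sub>2 - \<mu>\<^sub>1\<^sup>2) / e) * \<epsilon>\<^sup>2)) \<in> o[at_right 0](\<lambda>\<epsilon>. \<epsilon>\<^sup>2)"
      by (intro smallo) simp
  qed
qed

end
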